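(* For every odd $n\ge 3$, the dimension of $P_{\mathrm{VSASM}}$ is $\frac{(n-3)^2}{2}$.
   Context: An $n\times n$ alternating sign matrix (ASM) is an $n\times n$ matrix with entries in $\{0,1,-1\}$ such that in each row and each column the non-zero entries alternate in sign and the first and last non-zero entries are $1$ (so every row and column sums to $1$). A VSASM (vertically symmetric ASM) is an $n\times n$ ASM $X$ with $x_{i,j}=x_{i,n+1-j}$ for all $i,j\in\{1,\dots,n\}$. $P_{\mathrm{VSASM}}\subseteq\mathbb R^{n\times n}$ is the convex hull of all $n\times n$ VSASMs. The dimension of a polytope is the dimension of its affine hull. *)

theory Defs
  imports "HOL-Analysis.Analysis"
begin

text \<open>
  An \<open>n \<times> n\<close> matrix is an element of \<open>real ^ 'n ^ 'n\<close>, where the index type \<open>'n\<close> is finite and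
  linearly ordered and \<open>n = CARD('n)\<close>; \<open>X $ i $ j\<close> is the entry in row \<open>i\<close> and column \<open>j\<close>. The
  order of \<open>'n\<close> is the order of the rows and columns; \<open>pos\<close> is the unique order isomorphism from
  \<open>'n\<close> to \<open>{1..n}\<close>. Every odd \<open>n \<ge> 3\<close> is the size of such a type, for example of a numeral type.
\<close>

definition pos :: "'n::{finite,linorder} \<Rightarrow> nat" where
  "pos i = card {..i}"

lemma strict_mono_pos: "strict_mono pos"
  unfolding strict_mono_def pos_def
  by (auto intro!: psubset_card_mono)

lemma bij_betw_pos: "bij_betw (pos :: 'n::{finite,linorder} \<Rightarrow> nat) UNIV {1..CARD('n)}"
proof -
  have inj: "inj (pos :: 'n \<Rightarrow> nat)"
    by (rule strict_mono_imp_inj_on[OF strict_mono_pos])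
  have "range (pos :: 'n \<Rightarrow> nat) \<subseteq> {1..CARD('n)}"
    by (auto simp: pos_def Suc_le_eq card_gt_0_iff intro!: card_mono)
  moreover have "card (range (pos :: 'n \<Rightarrow> nat)) = card {1..CARD('n)}"
    using inj by (simp add: card_image)
  ultimately have "range (pos :: 'n \<Rightarrow> nat) = {1..CARD('n)}"
    by (intro card_subset_eq) auto
  with inj show ?thesis
    by (simp add: bij_betw_def)
qed

text \<open>
  The condition on a single row or column. The existence of a non-zero entry is implicit in
  speaking of the first and the last one.
\<close>

definition alternating_sign :: "('n::{finite,linorder} \<Rightarrow> real) \<Rightarrow> bool" where
  "alternating_sign f \<longleftrightarrow>
     (\<forall>i. f i \<in> {0, 1, -1}) \<and>
     (\<exists>i. f i \<noteq> 0) \<and>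
     (\<forall>i j. i < j \<and> f i \<noteq> 0 \<and> f j \<noteq> 0 \<and> (\<forall>k. i < k \<and> k < j \<longrightarrow> f k = 0) \<longrightarrow> f j = - f i) \<and>
     (\<forall>i. f i \<noteq> 0 \<and> (\<forall>k<i. f k = 0) \<longrightarrow> f i = 1) \<and>
     (\<forall>i. f i \<noteq> 0 \<and> (\<forall>k>i. f k = 0) \<longrightarrow> f i = 1)"

definition is_ASM :: "real ^ ('n::{finite,linorder}) ^ ('n::{finite,linorder}) \<Rightarrow> bool" where
  "is_ASM X \<longleftrightarrow>
     (\<forall>i. alternating_sign (\<lambda>j. X $ i $ j)) \<and> (\<forall>j. alternating_sign (\<lambda>i. X $ i $ j))"

definition is_VSASM :: "real ^ ('n::{finite,linorder}) ^ ('n::{finite,linorder}) \<Rightarrow> bool" where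
  "is_VSASM X \<longleftrightarrow>
     is_ASM X \<and> (\<forall>i j j'. pos j' = CARD('n) + 1 - pos j \<longrightarrow> X $ i $ j = X $ i $ j')"

definition P_VSASM :: "(real ^ ('n::{finite,linorder}) ^ ('n::{finite,linorder})) set" where
  "P_VSASM = convex hull {X. is_VSASM X}"

end

theory Submission
  imports Defs
begin

text \<open>
  Write \<open>n = 2m + 1\<close>. A matrix is determined by its corner sums \<open>H a b\<close> (the sum of the entries in the
  first \<open>a\<close> rows and \<open>b\<close> columns), and ASMs correspond to the functions \<open>H\<close> with steps in \<open>{0, 1}\<close> and
  the boundary values \<open>H 0 b = H a 0 = 0\<close>, \<open>H n b = b\<close>, \<open>H a n = a\<close>. Vertical symmetry reads
  \<open>H a (n - b) = a - H a b\<close>. Together with the step condition in the middle it forces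
  \<open>H a m = a div 2\<close>, hence also \<open>H 1 b = 0\<close> and \<open>H (n - 1) b = b\<close> for \<open>b \<le> m\<close>, so only the values at the
  \<open>2(m - 1)\<^sup>2\<close> cells with \<open>2 \<le> a \<le> n - 2\<close> and \<open>1 \<le> b \<le> m - 1\<close> are free. Conversely, each of these values
  can be changed by 1 on its own: between the pointwise smallest and largest admissible functions
  \<open>max 0 (a div 2 - m + b)\<close> and \<open>min b (a div 2)\<close> there are two admissible functions that differ only
  at the given cell.
\<close>

text \<open>Unlike \<open>vec\<close>, the notation \<open>real ^ 'n\<close> imposes a sort on \<open>'n\<close> at each occurrence.\<close>

type_synonym 'n square = "((real, 'n) vec, 'n) vec"

section \<open>Partial sums of a row or column\<close>

text \<open>Prefixes are cut off by a natural number instead of an index, so that the empty prefix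
  \<open>k = 0\<close> is included and sums can be treated by induction on \<open>k\<close>.\<close>

definition psum :: "('n::{finite,linorder} \<Rightarrow> real) \<Rightarrow> nat \<Rightarrow> real" where
  "psum f k = sum f {i. pos i \<le> k}"

lemma pos_bounds:
  fixes i :: "'n::{finite,linorder}"
  shows "1 \<le> pos i" "pos i \<le> CARD('n)"
proof -
  have "pos i \<in> {1..CARD('n)}"
    by (rule bij_betw_apply[OF bij_betw_pos]) simp
  thus "1 \<le> pos i" "pos i \<le> CARD('n)" by auto
qed

lemma pos_eq_iff: "pos i = pos j \<longleftrightarrow> i = j"
  using strict_mono_pos by (metis strict_mono_eq)

lemma pos_less_iff: "pos i < pos j \<longleftrightarrow> i < j"
  using strict_mono_pos by (metis strict_mono_less)

lemma pos_eq_Suc: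
  assumes "k < CARD('n::{finite,linorder})"
  obtains i :: "'n::{finite,linorder}" where "pos i = Suc k"
proof -
  have "Suc k \<in> range (pos :: 'n \<Rightarrow> nat)"
    using bij_betw_pos[where 'n='n] assms by (auto simp: bij_betw_def)
  thus ?thesis using that by auto
qed

lemma pos_nonzero [simp]: "pos i \<noteq> 0"
  using pos_bounds(1)[of i] by simp

lemma psum_0 [simp]: "psum f 0 = 0"
  by (simp add: psum_def)

lemma psum_pos: "psum f (pos j) = psum f (pos j - 1) + f j"
proof -
  have "{i. pos i \<le> pos j} = insert j {i. pos i \<le> pos j - 1}"
    using pos_bounds(1)[of j] by (auto simp: pos_eq_iff le_less_Suc_eq dest: le_neq_implies_less)
  moreover have "j \<notin> {i. pos i \<le> pos j - 1}" using pos_bounds(1)[of j] by auto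
  ultimately show ?thesis by (simp add: psum_def)
qed

lemma psum_Suc: "pos j = Suc k \<Longrightarrow> psum f (Suc k) = psum f k + f j"
  using psum_pos[of f j] by simp

lemma psum_diff: "psum (\<lambda>i. f i - g i) k = psum f k - psum g k"
  by (simp add: psum_def sum_subtractf)

lemma psum_eq_if_zero_between:
  assumes "a \<le> b" "b \<le> CARD('n)" "\<And>i::'n::{finite,linorder}. a < pos i \<Longrightarrow> pos i \<le> b \<Longrightarrow> f i = 0"
  shows "psum f a = psum f b"
  unfolding psum_def by (rule sum.mono_neutral_left) (use assms in force)+

lemma psum_telescope:
  assumes "k \<le> CARD('n)"
  shows "psum (\<lambda>i::'n::{finite,linorder}. g (pos i) - g (pos i - 1)) k = g k - g 0"
  using assms
proof (induction k)
  case (Suc k)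
  obtain j :: 'n where "pos j = Suc k" by (rule pos_eq_Suc[of k]) (use Suc.prems in auto)
  with Suc show ?case by (simp add: psum_Suc)
qed simp

text \<open>Each non-zero entry is a jump of the partial sums, which stay constant in between. With
  only the levels 0 and 1 available, consecutive jumps go in opposite directions; the first one
  leaves level 0 and the last one arrives at the total 1.\<close>

lemma alternating_sign_if_psum:
  fixes f :: "'n::{finite,linorder} \<Rightarrow> real"
  assumes 01: "\<And>k. k \<le> CARD('n) \<Longrightarrow> psum f k \<in> {0,1}" and total: "psum f CARD('n) = 1"
  shows "alternating_sign f"
  unfolding alternating_sign_def
proof (intro conjI allI impI)
  have p: "psum f (pos i) \<in> {0,1}" "psum f (pos i - 1) \<in> {0,1}" for i :: 'n
    using 01 pos_bounds(2)[of i] by (auto simp: le_diff_conv)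
  show "f i \<in> {0, 1, -1}" for i
    using p[of i] psum_pos[of f i] by auto
  show "\<exists>i. f i \<noteq> 0"
  proof (rule ccontr)
    assume "\<not> ?thesis"
    hence "psum f CARD('n) = 0" by (simp add: psum_def)
    thus False using total by simp
  qed
  show "f j = - f i" if "i < j \<and> f i \<noteq> 0 \<and> f j \<noteq> 0 \<and> (\<forall>k. i < k \<and> k < j \<longrightarrow> f k = 0)" for i j
  proof -
    have "psum f (pos i) = psum f (pos j - 1)"
    proof (rule psum_eq_if_zero_between)
      show "pos i \<le> pos j - 1" using that pos_less_iff[of i j] by auto
      show "pos j - 1 \<le> CARD('n)" using pos_bounds(2)[of j] by linarith
      show "f k = 0" if "pos i < pos k" "pos k \<le> pos j - 1" for k
        using that \<open>i < j \<and> _\<close> pos_less_iff[of i k] pos_less_iff[of k j] by auto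
    qed
    thus ?thesis using p[of i] p[of j] psum_pos[of f i] psum_pos[of f j] that by auto
  qed
  show "f i = 1" if "f i \<noteq> 0 \<and> (\<forall>k<i. f k = 0)" for i
  proof -
    have "psum f 0 = psum f (pos i - 1)"
    proof (rule psum_eq_if_zero_between)
      show "pos i - 1 \<le> CARD('n)" using pos_bounds(2)[of i] by linarith
      show "f k = 0" if "0 < pos k" "pos k \<le> pos i - 1" for k
        using that \<open>f i \<noteq> 0 \<and> _\<close> pos_less_iff[of k i] by auto
    qed simp
    thus ?thesis using p[of i] psum_pos[of f i] that by auto
  qed
  show "f i = 1" if "f i \<noteq> 0 \<and> (\<forall>k>i. f k = 0)" for i
  proof -
    have "psum f (pos i) = psum f CARD('n)"
      using that by (intro psum_eq_if_zero_between) (auto simp: pos_less_iff pos_bounds)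
    thus ?thesis using p[of i] psum_pos[of f i] that total by auto
  qed
qed

text \<open>Induction on \<open>k\<close>: the partial sum is 0 up to the first non-zero entry and
  afterwards records the sign of the latest one, so alternation toggles it between 1 and 0. The very
  last non-zero entry is 1, which gives the total.\<close>

lemma alternating_sign_psum:
  fixes f :: "'n::{finite,linorder} \<Rightarrow> real"
  assumes "alternating_sign f"
  shows "k \<le> CARD('n) \<Longrightarrow> psum f k \<in> {0,1}" and "psum f CARD('n) = 1"
proof -
  have val: "f i \<in> {0,1,-1}" for i
    using assms by (simp add: alternating_sign_def)
  have nz: "\<exists>i. f i \<noteq> 0"
    using assms by (simp add: alternating_sign_def)
  have alt: "f j = - f i" if "i < j" "f i \<noteq> 0" "f j \<noteq> 0" "\<And>k. i < k \<Longrightarrow> k < j \<Longrightarrow> f k = 0" for i j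
    using assms that unfolding alternating_sign_def by blast
  have fst1: "f i = 1" if "f i \<noteq> 0" "\<And>k. k < i \<Longrightarrow> f k = 0" for i
    using assms that unfolding alternating_sign_def by blast
  have lst1: "f i = 1" if "f i \<noteq> 0" "\<And>k. k > i \<Longrightarrow> f k = 0" for i
    using assms that unfolding alternating_sign_def by blast
  define none where "none k \<longleftrightarrow> (\<forall>i. pos i \<le> k \<longrightarrow> f i = 0)" for k
  define lastnz where
    "lastnz k i \<longleftrightarrow> pos i \<le> k \<and> f i \<noteq> 0 \<and> (\<forall>j. pos i < pos j \<and> pos j \<le> k \<longrightarrow> f j = 0)" for k i
  have inv: "none k \<and> psum f k = 0 \<or> (\<exists>i. lastnz k i \<and> psum f k = (if f i = 1 then 1 else 0))"
    if "k \<le> CARD('n)" for k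
    using that
  proof (induction k)
    case 0
    show ?case by (auto simp: none_def)
  next
    case (Suc k)
    obtain j :: 'n where j: "pos j = Suc k" by (rule pos_eq_Suc[of k]) (use Suc.prems in auto)
    have le: "pos i \<le> Suc k \<longleftrightarrow> pos i \<le> k \<or> i = j" for i
      using j pos_eq_iff[of i j] by (auto simp: le_Suc_eq)
    note s = psum_Suc[OF j, of f]
    from Suc consider "none k" "psum f k = 0"
      | i where "lastnz k i" "psum f k = (if f i = 1 then 1 else 0)" by auto
    thus ?case
    proof cases
      case 1
      show ?thesis
      proof (cases "f j = 0")
        case True
        thus ?thesis using 1 s by (auto simp: none_def le)
      next
        case False
        have "f j = 1"
          using False 1 j by (intro fst1) (auto simp: none_def simp flip: pos_less_iff)
        moreover have "lastnz (Suc k) j" using False j by (auto simp: lastnz_def)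
        ultimately show ?thesis using s 1 by auto
      qed
    next
      case 2
      show ?thesis
      proof (cases "f j = 0")
        case True
        hence "lastnz (Suc k) i" using 2 by (auto simp: lastnz_def le)
        thus ?thesis using 2 s True by auto
      next
        case False
        have "f j = - f i"
          using False 2 j by (intro alt) (auto simp: lastnz_def simp flip: pos_less_iff)
        moreover have "lastnz (Suc k) j" using False j by (auto simp: lastnz_def)
        moreover have "f i = 1 \<or> f i = -1" using val[of i] 2 by (auto simp: lastnz_def)
        hence "psum f (Suc k) = (if f j = 1 then 1 else 0)"
          using s 2(2) \<open>f j = - f i\<close> by (elim disjE) simp_all
        ultimately show ?thesis by blast
      qed
    qed
  qed
  show "psum f k \<in> {0,1}" if "k \<le> CARD('n)" for k
    using inv[OF that] by (auto split: if_splits)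
  have "\<not> none CARD('n)" using nz by (auto simp: none_def pos_bounds)
  then obtain i where i: "lastnz CARD('n) i" "psum f CARD('n) = (if f i = 1 then 1 else 0)"
    using inv[of "CARD('n)"] by auto
  moreover have "f i = 1"
    using i by (intro lst1) (auto simp: lastnz_def pos_bounds pos_less_iff)
  ultimately show "psum f CARD('n) = 1" by simp
qed

text \<open>Increasing \<open>b\<close> adds an entry to the first sum and removes its mirror image,
  which has the same value, from the second.\<close>

lemma psum_symmetric:
  fixes f :: "'n::{finite,linorder} \<Rightarrow> real"
  assumes sym: "\<And>j j'. pos j' = CARD('n) + 1 - pos j \<Longrightarrow> f j = f j'" and "b \<le> CARD('n)"
  shows "psum f b + psum f (CARD('n) - b) = psum f CARD('n)"
  using assms(2)
proof (induction b)
  case (Suc b)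
  obtain j :: 'n where j: "pos j = Suc b" by (rule pos_eq_Suc[of b]) (use Suc.prems in auto)
  obtain j' :: 'n where j': "pos j' = Suc (CARD('n) - Suc b)"
    by (rule pos_eq_Suc[of "CARD('n) - Suc b"]) (use Suc.prems in auto)
  have "f j = f j'" using j j' Suc.prems by (intro sym) auto
  moreover have "Suc (CARD('n) - Suc b) = CARD('n) - b" using Suc.prems by simp
  ultimately show ?case using Suc psum_Suc[OF j, of f] psum_Suc[OF j', of f] by simp
qed simp

section \<open>Corner sums\<close>

definition corner_sum :: "'n::{finite,linorder} square \<Rightarrow> nat \<Rightarrow> nat \<Rightarrow> real" where
  "corner_sum X a b = psum (\<lambda>i. psum (\<lambda>j. X $ i $ j) b) a"

text \<open>Inclusion-exclusion for a single cell, hence the inverse of \<open>corner_sum\<close>.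
  Since \<open>pos i\<close> is at least 1, the subtractions never truncate.\<close>

definition second_difference :: "(nat \<Rightarrow> nat \<Rightarrow> real) \<Rightarrow> 'n::{finite,linorder} square" where
  "second_difference H = (\<chi> i j. (H (pos i) (pos j) - H (pos i - 1) (pos j))
      - (H (pos i) (pos j - 1) - H (pos i - 1) (pos j - 1)))"

definition corner_sum_function :: "nat \<Rightarrow> (nat \<Rightarrow> nat \<Rightarrow> real) \<Rightarrow> bool" where
  "corner_sum_function n H \<longleftrightarrow>
     (\<forall>b\<le>n. H 0 b = 0 \<and> H n b = real b) \<and> (\<forall>a\<le>n. H a 0 = 0 \<and> H a n = real a) \<and>
     (\<forall>a<n. \<forall>b\<le>n. H (Suc a) b - H a b \<in> {0,1}) \<and>
     (\<forall>a\<le>n. \<forall>b<n. H a (Suc b) - H a b \<in> {0,1})"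

lemma corner_sum_swap: "corner_sum X a b = psum (\<lambda>j. psum (\<lambda>i. X $ i $ j) a) b"
  unfolding corner_sum_def psum_def by (rule sum.swap)

lemma linear_corner_sum: "linear (\<lambda>X. corner_sum X a b)"
  by (rule linearI) (simp_all add: corner_sum_def psum_def sum.distrib sum_distrib_left)

lemma corner_sum_0 [simp]: "corner_sum X 0 b = 0" "corner_sum X a 0 = 0"
  by (simp_all add: corner_sum_def) (simp add: psum_def)

lemma corner_sum_row_step:
  "pos i = Suc a \<Longrightarrow> corner_sum X (Suc a) b - corner_sum X a b = psum (\<lambda>j. X $ i $ j) b"
  unfolding corner_sum_def by (subst psum_Suc) auto

lemma corner_sum_column_step:
  "pos j = Suc b \<Longrightarrow> corner_sum X a (Suc b) - corner_sum X a b = psum (\<lambda>i. X $ i $ j) a"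
  unfolding corner_sum_swap by (subst psum_Suc) auto

section \<open>Corner sums and second differences as inverse maps\<close>

lemma psum_row_second_difference:
  fixes i :: "'n::{finite,linorder}"
  assumes "b \<le> CARD('n)" "H (pos i) 0 = 0" "H (pos i - 1) 0 = 0"
  shows "psum (\<lambda>j. second_difference H $ i $ j) b = H (pos i) b - H (pos i - 1) b"
  using psum_telescope[OF assms(1), of "\<lambda>b. H (pos i) b - H (pos i - 1) b"] assms
  by (simp add: second_difference_def)

lemma psum_column_second_difference:
  fixes j :: "'n::{finite,linorder}"
  assumes "a \<le> CARD('n)" "H 0 (pos j) = 0" "H 0 (pos j - 1) = 0"
  shows "psum (\<lambda>i. second_difference H $ i $ j) a = H a (pos j) - H a (pos j - 1)"
  using psum_telescope[OF assms(1), of "\<lambda>a. H a (pos j) - H a (pos j - 1)"] assms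
  by (simp add: second_difference_def algebra_simps)

text \<open>The sum telescopes along the rows and then along the columns, and the zero border
  removes the remaining terms. Flips are covered too, although their steps may be -1.\<close>

lemma corner_sum_second_difference:
  assumes "a \<le> CARD('n::{finite,linorder})" "b \<le> CARD('n)"
    and "\<And>a. a \<le> CARD('n) \<Longrightarrow> H a 0 = 0" "\<And>b. b \<le> CARD('n) \<Longrightarrow> H 0 b = 0"
  shows "corner_sum (second_difference H :: 'n square) a b = H a b"
proof -
  have "psum (\<lambda>j. (second_difference H :: 'n square) $ i $ j) b = H (pos i) b - H (pos i - 1) b" for i
    using pos_bounds(2)[of i] by (intro psum_row_second_difference assms) auto
  thus ?thesis
    using psum_telescope[OF assms(1), of "\<lambda>a. H a b"] assms by (simp add: corner_sum_def)
qed

lemma second_difference_cong: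
  assumes "\<And>a b. a \<le> CARD('n::{finite,linorder}) \<Longrightarrow> b \<le> CARD('n) \<Longrightarrow> H a b = H' a b"
  shows "second_difference H = (second_difference H' :: 'n square)"
proof -
  have "pos i - 1 \<le> CARD('n)" for i :: 'n using pos_bounds(2)[of i] by simp
  thus ?thesis unfolding second_difference_def vec_eq_iff by (simp add: assms pos_bounds)
qed

lemma second_difference_corner_sum: "second_difference (corner_sum X) = X"
proof -
  have *: "Suc (pos i - 1) = pos i" for i :: 'a using pos_bounds(1)[of i] by simp
  have "corner_sum X (pos i) b - corner_sum X (pos i - 1) b = psum (\<lambda>j. X $ i $ j) b" for i b
    using corner_sum_row_step[of i "pos i - 1" X b] * by simp
  thus ?thesis
    unfolding second_difference_def vec_eq_iff by (simp add: psum_pos)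
qed

lemma second_difference_diff:
  "second_difference (\<lambda>a b. H a b - H' a b) = second_difference H - second_difference H'"
  by (simp add: second_difference_def vec_eq_iff)

lemma second_difference_sum:
  "second_difference (\<lambda>a b. \<Sum>k\<in>I. u k * H k a b) = (\<Sum>k\<in>I. u k *\<^sub>R second_difference (H k))"
  unfolding second_difference_def vec_eq_iff sum_component vector_scaleR_component vec_lambda_beta
  by (simp only: sum_subtractf right_diff_distrib real_scaleR_def) simp

section \<open>ASMs and VSASMs in terms of corner sums\<close>

lemma corner_sum_function_if_ASM:
  fixes X :: "'n::{finite,linorder} square"
  assumes "is_ASM X"
  shows "corner_sum_function CARD('n) (corner_sum X)"
proof -
  have row: "alternating_sign (\<lambda>j. X $ i $ j)" and col: "alternating_sign (\<lambda>j. X $ j $ i)" for i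
    using assms by (auto simp: is_ASM_def)
  \<comment> \<open>The constant 1 telescopes \<open>real\<close>, so the first \<open>k\<close>
    rows or columns, each of total 1, contribute \<open>real k\<close>.\<close>
  have "real (pos i) - real (pos i - 1) = 1" for i :: 'n
    using pos_bounds(1)[of i] by (simp add: of_nat_diff)
  hence total: "psum (\<lambda>i::'n. 1) k = real k" if "k \<le> CARD('n)" for k
    using psum_telescope[OF that, of real] by simp
  have "corner_sum X (Suc a) b - corner_sum X a b \<in> {0,1}" if ab: "a < CARD('n)" "b \<le> CARD('n)" for a b
  proof -
    obtain i :: 'n where "pos i = Suc a" by (rule pos_eq_Suc[of a]) (use ab in auto)
    thus ?thesis using alternating_sign_psum(1)[OF row ab(2)] corner_sum_row_step by metis
  qed
  moreover have "corner_sum X a (Suc b) - corner_sum X a b \<in> {0,1}" if ab: "a \<le> CARD('n)" "b < CARD('n)" for a b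
  proof -
    obtain i :: 'n where "pos i = Suc b" by (rule pos_eq_Suc[of b]) (use ab in auto)
    thus ?thesis using alternating_sign_psum(1)[OF col ab(1)] corner_sum_column_step by metis
  qed
  moreover have "corner_sum X a CARD('n) = real a" if "a \<le> CARD('n)" for a
    by (simp add: corner_sum_def alternating_sign_psum(2)[OF row] total that)
  moreover have "corner_sum X CARD('n) a = real a" if "a \<le> CARD('n)" for a
    by (simp add: corner_sum_swap alternating_sign_psum(2)[OF col] total that)
  ultimately show ?thesis unfolding corner_sum_function_def by auto
qed

lemma is_ASM_second_difference:
  assumes H: "corner_sum_function CARD('n) H"
  shows "is_ASM (second_difference H :: 'n::{finite,linorder} square)"
proof -
  let ?X = "second_difference H :: 'n square"
  have p: "pos i - 1 < CARD('n)" "Suc (pos i - 1) = pos i" "real (pos i - 1) = real (pos i) - 1"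
      "pos i - 1 \<le> CARD('n)" for i :: 'n
    using pos_bounds[of i] by (auto simp: of_nat_diff)
  have "alternating_sign (\<lambda>j. ?X $ i $ j)" for i
  proof (rule alternating_sign_if_psum)
    have e: "psum (\<lambda>j. ?X $ i $ j) b = H (pos i) b - H (pos i - 1) b" if "b \<le> CARD('n)" for b
      using H p(4)[of i] by (intro psum_row_second_difference that) (auto simp: corner_sum_function_def pos_bounds)
    show "psum (\<lambda>j. ?X $ i $ j) b \<in> {0,1}" if "b \<le> CARD('n)" for b
      using H that p(1,2)[of i] unfolding e[OF that] corner_sum_function_def by metis
    show "psum (\<lambda>j. ?X $ i $ j) CARD('n) = 1"
      using H p(3,4)[of i] by (simp add: e corner_sum_function_def pos_bounds)
  qed
  moreover have "alternating_sign (\<lambda>i. ?X $ i $ j)" for j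
  proof (rule alternating_sign_if_psum)
    have e: "psum (\<lambda>i. ?X $ i $ j) a = H a (pos j) - H a (pos j - 1)" if "a \<le> CARD('n)" for a
      using H p(4)[of j] by (intro psum_column_second_difference that) (auto simp: corner_sum_function_def pos_bounds)
    show "psum (\<lambda>i. ?X $ i $ j) a \<in> {0,1}" if "a \<le> CARD('n)" for a
      using H that p(1,2)[of j] unfolding e[OF that] corner_sum_function_def by metis
    show "psum (\<lambda>i. ?X $ i $ j) CARD('n) = 1"
      using H p(3,4)[of j] by (simp add: e corner_sum_function_def pos_bounds)
  qed
  ultimately show ?thesis by (simp add: is_ASM_def)
qed

lemma corner_sum_VSASM_mirror:
  fixes X :: "'n::{finite,linorder} square"
  assumes "is_VSASM X" "a \<le> CARD('n)" "b \<le> CARD('n)"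
  shows "corner_sum X a (CARD('n) - b) = real a - corner_sum X a b"
proof -
  have "psum (\<lambda>j. X $ i $ j) (CARD('n) - b) = psum (\<lambda>j. X $ i $ j) CARD('n) - psum (\<lambda>j. X $ i $ j) b" for i
    using psum_symmetric[OF _ assms(3), of "\<lambda>j. X $ i $ j"] assms(1)
    by (auto simp: is_VSASM_def algebra_simps)
  hence "corner_sum X a (CARD('n) - b) = corner_sum X a CARD('n) - corner_sum X a b"
    by (simp add: corner_sum_def psum_diff)
  moreover have "corner_sum X a CARD('n) = real a"
    using corner_sum_function_if_ASM[of X] assms by (auto simp: is_VSASM_def corner_sum_function_def)
  ultimately show ?thesis by simp
qed

text \<open>Reflection exchanges the left and right borders of a column and negates the corner sums
  there up to the summand \<open>real a\<close>. The two sign changes compensate and the summands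
  \<open>real a\<close> cancel.\<close>

lemma is_VSASM_second_difference:
  assumes H: "corner_sum_function CARD('n) H"
    and mirror: "\<And>a b. a \<le> CARD('n) \<Longrightarrow> b \<le> CARD('n) \<Longrightarrow> H a (CARD('n) - b) = real a - H a b"
  shows "is_VSASM (second_difference H :: 'n::{finite,linorder} square)"
  unfolding is_VSASM_def
proof (intro conjI allI impI is_ASM_second_difference[OF H])
  fix i j j' :: 'n
  assume j': "pos j' = CARD('n) + 1 - pos j"
  have e: "pos j' = CARD('n) - (pos j - 1)" "pos j' - 1 = CARD('n) - pos j"
    using j' pos_bounds[of j] by auto
  have le: "pos i - 1 \<le> CARD('n)" "pos j - 1 \<le> CARD('n)" "pos i \<le> CARD('n)" "pos j \<le> CARD('n)"
    using pos_bounds(2)[of i] pos_bounds(2)[of j] by auto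
  have "H a (pos j') = real a - H a (pos j - 1)" "H a (pos j' - 1) = real a - H a (pos j)"
    if "a \<le> CARD('n)" for a
    unfolding e(2) by (subst e(1)) (rule mirror[OF that le(2)] mirror[OF that le(4)])+
  thus "second_difference H $ i $ j = second_difference H $ i $ j'"
    using le by (simp add: second_difference_def)
qed

section \<open>Values forced by vertical symmetry\<close>

lemma corner_sum_function_Ints:
  assumes "corner_sum_function n H" "a \<le> n" "b \<le> n"
  shows "H a b \<in> \<int>"
  using assms(3)
proof (induction b)
  case 0
  thus ?case using assms by (simp add: corner_sum_function_def)
next
  case (Suc b)
  have "H a (Suc b) - H a b \<in> {0,1}" using assms Suc by (simp add: corner_sum_function_def)
  hence "H a (Suc b) - H a b \<in> \<int>" by auto
  hence "(H a (Suc b) - H a b) + H a b \<in> \<int>" using Suc by (intro Ints_add) auto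
  thus ?case by simp
qed

lemma corner_sum_function_increments:
  assumes "corner_sum_function n H" "a \<le> n" "b \<le> b'" "b' \<le> n"
  shows "H a b \<le> H a b'" "H a b' \<le> H a b + real (b' - b)"
proof -
  have "H a b \<le> H a b' \<and> H a b' \<le> H a b + real (b' - b)"
    using assms(3,4)
  proof (induction b' rule: dec_induct)
    case (step k)
    have "H a (Suc k) - H a k \<in> {0,1}" using assms step by (simp add: corner_sum_function_def)
    moreover have "real (Suc k - b) = real (k - b) + 1" using step by (simp add: Suc_diff_le)
    ultimately show ?case using step by auto
  qed simp
  thus "H a b \<le> H a b'" "H a b' \<le> H a b + real (b' - b)" by auto
qed

context
  fixes m n :: nat and H :: "nat \<Rightarrow> nat \<Rightarrow> real"
  assumes n: "n = 2 * m + 1" and H: "corner_sum_function n H"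
    and mirror: "\<And>a b. a \<le> n \<Longrightarrow> b \<le> n \<Longrightarrow> H a (n - b) = real a - H a b"
begin

text \<open>Columns \<open>m\<close> and \<open>m + 1\<close> are mirror images, so the step between
  them is \<open>real a - 2 * H a m\<close>. As \<open>H a m\<close> is an integer and the step is 0
  or 1, the step is the parity of \<open>a\<close>.\<close>

lemma symmetric_corner_sum_middle:
  assumes "a \<le> n"
  shows "H a m = real (a div 2)"
proof -
  have "H a (Suc m) = real a - H a m" using mirror[OF assms, of m] n by simp
  moreover have "H a (Suc m) - H a m \<in> {0,1}"
    using H assms n by (simp add: corner_sum_function_def)
  moreover obtain z where z: "H a m = of_int z"
    using corner_sum_function_Ints[OF H assms, of m] n by (auto elim: Ints_cases)
  ultimately have "real_of_int (int a - 2 * z) = 0 \<or> real_of_int (int a - 2 * z) = 1"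
    by auto
  hence "int a - 2 * z = 0 \<or> int a - 2 * z = 1" by linarith
  hence "z = int (a div 2)" by presburger
  thus ?thesis by (simp add: z)
qed

text \<open>Row 1 is monotone and is already squeezed between 0 in column 0 and
  \<open>1 div 2 = 0\<close> in column \<open>m\<close>.\<close>

lemma symmetric_corner_sum_first_row:
  assumes "b \<le> m"
  shows "H 1 b = 0"
proof -
  have "H 1 0 \<le> H 1 b" "H 1 b \<le> H 1 m"
    using n assms by (auto intro!: corner_sum_function_increments(1)[OF H])
  moreover have "H 1 0 = 0" using H n by (simp add: corner_sum_function_def)
  ultimately show ?thesis using symmetric_corner_sum_middle[of 1] n by simp
qed

text \<open>Row \<open>2 * m\<close> has to climb from 0 to \<open>m\<close> within \<open>m\<close>
  columns, so each of these steps is 1.\<close>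

lemma symmetric_corner_sum_last_row:
  assumes "b \<le> m"
  shows "H (2 * m) b = real b"
proof -
  have "H (2 * m) b \<le> H (2 * m) 0 + real (b - 0)" "H (2 * m) m \<le> H (2 * m) b + real (m - b)"
    using n assms corner_sum_function_increments(2)[OF H, of "2 * m" 0 b]
      corner_sum_function_increments(2)[OF H, of "2 * m" b m] by auto
  moreover have "H (2 * m) 0 = 0" using H n by (simp add: corner_sum_function_def)
  ultimately show ?thesis using symmetric_corner_sum_middle[of "2 * m"] n assms by simp
qed

end

section \<open>Flips of a single corner sum\<close>

text \<open>The effect of raising a symmetric corner sum function by 1 at \<open>p\<close>: the
  values at a cell and its mirror image add up to the row number, so the mirror image drops by
  1.\<close>

definition corner_flip :: "nat \<Rightarrow> nat \<times> nat \<Rightarrow> nat \<Rightarrow> nat \<Rightarrow> real" where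
  "corner_flip n p a b = (if (a, b) = p then 1 else if (a, n - b) = p then -1 else 0)"

text \<open>Only the columns \<open>0\<close> to \<open>m\<close> of \<open>g\<close> are consulted
  for \<open>b \<le> 2 * m + 1\<close>; the rest follows from the mirror rule. Integer values keep
  the case analyses of minima and maxima within linear integer arithmetic.\<close>

definition extend_mirror :: "nat \<Rightarrow> (nat \<Rightarrow> nat \<Rightarrow> int) \<Rightarrow> nat \<Rightarrow> nat \<Rightarrow> real" where
  "extend_mirror m g a b =
     (if b \<le> m then of_int (g a b) else real a - of_int (g a (2 * m + 1 - b)))"

lemma extend_mirror_mirror:
  "b \<le> 2 * m + 1 \<Longrightarrow> extend_mirror m g a (2 * m + 1 - b) = real a - extend_mirror m g a b"
  by (auto simp: extend_mirror_def)

text \<open>On the right half a downward step \<open>s\<close> becomes \<open>1 - s\<close>, and a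
  horizontal step is a step of the left half read backwards. Only the step across the middle is new,
  and \<open>mid\<close> turns it into the parity of \<open>a\<close>.\<close>

lemma corner_sum_function_extend_mirror:
  assumes top: "\<And>b. b \<le> m \<Longrightarrow> g 0 b = 0" and bot: "\<And>b. b \<le> m \<Longrightarrow> g (2 * m + 1) b = int b"
    and left: "\<And>a. a \<le> 2 * m + 1 \<Longrightarrow> g a 0 = 0"
    and mid: "\<And>a. a \<le> 2 * m + 1 \<Longrightarrow> g a m = int (a div 2)"
    and down: "\<And>a b. a \<le> 2 * m \<Longrightarrow> b \<le> m \<Longrightarrow> g (Suc a) b - g a b \<in> {0,1}"
    and right: "\<And>a b. a \<le> 2 * m + 1 \<Longrightarrow> b < m \<Longrightarrow> g a (Suc b) - g a b \<in> {0,1}"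
  shows "corner_sum_function (2 * m + 1) (extend_mirror m g)"
proof -
  let ?H = "extend_mirror m g"
  have of01: "real_of_int z \<in> {0,1}" if "z \<in> {0,1}" for z using that by auto
  have "?H (Suc a) b - ?H a b \<in> {0,1}" if "a < 2 * m + 1" "b \<le> 2 * m + 1" for a b
  proof (cases "b \<le> m")
    case True
    thus ?thesis using of01[OF down[of a b]] that by (simp add: extend_mirror_def)
  next
    case False
    hence "2 * m + 1 - b \<le> m" by simp
    thus ?thesis using False of01[OF down[of a "2 * m + 1 - b"]] that by (auto simp: extend_mirror_def)
  qed
  moreover have "?H a (Suc b) - ?H a b \<in> {0,1}" if "a \<le> 2 * m + 1" "b < 2 * m + 1" for a b
  proof -
    consider "b < m" | "b = m" | "m < b" by linarith
    thus ?thesis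
    proof cases
      case 1
      thus ?thesis using of01[OF right[of a b]] that by (simp add: extend_mirror_def)
    next
      case 2
      have "real a - 2 * real (a div 2) = real (a mod 2)"
        by (metis add_diff_cancel_left' mult_div_mod_eq of_nat_add of_nat_mult of_nat_numeral)
      moreover have "a mod 2 = 0 \<or> a mod 2 = 1" by auto
      ultimately have "real a - 2 * real (a div 2) \<in> {0,1}" by auto
      thus ?thesis using 2 mid[of a] that by (simp add: extend_mirror_def)
    next
      case 3
      have "2 * m + 1 - b = Suc (2 * m - b)" using that by simp
      thus ?thesis using 3 of01[OF right[of a "2 * m - b"]] that by (auto simp: extend_mirror_def)
    qed
  qed
  moreover have "?H 0 b = 0 \<and> ?H (2 * m + 1) b = real b" if "b \<le> 2 * m + 1" for b
  proof (cases "b \<le> m")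
    case True
    thus ?thesis by (simp add: extend_mirror_def top bot[simplified])
  next
    case False
    hence "2 * m + 1 - b \<le> m" by simp
    thus ?thesis using False that top bot[of "2 * m + 1 - b"]
      by (simp add: extend_mirror_def of_nat_diff)
  qed
  moreover have "?H a 0 = 0 \<and> ?H a (2 * m + 1) = real a" if "a \<le> 2 * m + 1" for a
    using left[OF that] by (simp add: extend_mirror_def)
  ultimately show ?thesis unfolding corner_sum_function_def by blast
qed

text \<open>Column \<open>m\<close> has the value \<open>a div 2\<close>, and the
  \<open>m - b\<close> steps leading there from column \<open>b\<close> are at most 1 each.\<close>

definition lower_corner :: "nat \<Rightarrow> nat \<Rightarrow> nat \<Rightarrow> int" where
  "lower_corner m a b = max 0 (int (a div 2) - int m + int b)"

definition upper_corner :: "nat \<Rightarrow> nat \<Rightarrow> int" where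
  "upper_corner a b = min (int b) (int (a div 2))"

text \<open>For \<open>b \<le> m\<close> the two bounds agree in rows 0, 1, \<open>2 * m\<close>,
  \<open>2 * m + 1\<close> and in columns 0 and \<open>m\<close>. Clamping therefore produces the
  forced values there, whatever \<open>L\<close> is.\<close>

definition clamp_corner :: "nat \<Rightarrow> (nat \<Rightarrow> nat \<Rightarrow> int) \<Rightarrow> nat \<Rightarrow> nat \<Rightarrow> int" where
  "clamp_corner m L a b = min (upper_corner a b) (max (lower_corner m a b) (L a b))"

text \<open>Pointwise minima and maxima of functions with steps 0 and 1 again have steps 0 and 1.\<close>

lemma corner_sum_function_clamp:
  assumes "\<And>a b. L (Suc a) b - L a b \<in> {0,1}" "\<And>a b. L a (Suc b) - L a b \<in> {0,1}"
  shows "corner_sum_function (2 * m + 1) (extend_mirror m (clamp_corner m L))"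
proof (rule corner_sum_function_extend_mirror)
  have clamp: "min u' (max l' x') - min u (max l x) \<in> {0,1}"
    if "u' - u \<in> {0,1}" "l' - l \<in> {0,1}" "x' - x \<in> {0,1}" for u u' l l' x x' :: int
    using that by (auto simp: min_def max_def)
  show "clamp_corner m L (Suc a) b - clamp_corner m L a b \<in> {0,1}" for a b
  proof -
    have "Suc a div 2 = a div 2 \<or> Suc a div 2 = Suc (a div 2)" by presburger
    thus ?thesis unfolding clamp_corner_def
      by (intro clamp assms) (auto simp: lower_corner_def upper_corner_def min_def max_def)
  qed
  show "clamp_corner m L a (Suc b) - clamp_corner m L a b \<in> {0,1}" for a b
    unfolding clamp_corner_def
    by (intro clamp assms) (auto simp: lower_corner_def upper_corner_def min_def max_def)
qed (auto simp: clamp_corner_def lower_corner_def upper_corner_def)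

text \<open>Clamping a two-level staircase whose step passes on either side of the cell \<open>(a, b)\<close> gives two
  matrices that differ by a flip at that cell.\<close>

lemma flip_VSASM:
  assumes n: "CARD('n::{finite,linorder}) = 2 * m + 1"
    and a: "2 \<le> a" "a < 2 * m" and b: "1 \<le> b" "b < m"
  obtains X Y :: "'n::{finite,linorder} square" where
    "is_VSASM X" "is_VSASM Y" "X - Y = second_difference (corner_flip CARD('n) (a, b))"
proof -
  define c where "c = lower_corner m a b"
  \<comment> \<open>The level rises from \<open>c\<close> to \<open>c + 1\<close> across the
    antidiagonal through \<open>(a, b)\<close>; \<open>s\<close> decides on which side of it the
    cell itself lies. Both choices keep the steps in 0 and 1.\<close>
  define L where "L s x y = c + (if x + y > a + b \<or> s \<and> x = a \<and> y = b then 1 else 0)"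
    for s :: bool and x y :: nat
  define H where "H s = extend_mirror m (clamp_corner m (L s))" for s
  have H: "corner_sum_function CARD('n) (H s)" for s
    unfolding H_def n by (rule corner_sum_function_clamp) (auto simp: L_def)
  have vs: "is_VSASM (second_difference (H s) :: 'n square)" for s
    by (intro is_VSASM_second_difference H) (unfold H_def n, rule extend_mirror_mirror)
  \<comment> \<open>Each of the four bounds on \<open>a\<close> and \<open>b\<close> yields one of
    the four comparisons between the terms of the maximum and of the minimum. Hence clamping changes
    neither \<open>c\<close> nor \<open>c + 1\<close> at \<open>(a, b)\<close>.\<close>
  have c: "c + 1 \<le> upper_corner a b"
    using a b by (auto simp: c_def lower_corner_def upper_corner_def)
  have g: "clamp_corner m (L True) x y - clamp_corner m (L False) x y = (if (x, y) = (a, b) then 1 else 0)" for x y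
    using c by (auto simp: clamp_corner_def L_def c_def)
  have "H True x y - H False x y = corner_flip CARD('n) (a, b) x y" if "y \<le> CARD('n)" for x y
  proof (cases "y \<le> m")
    case True
    thus ?thesis using g[of x y] b n
      by (auto simp: H_def extend_mirror_def corner_flip_def simp flip: of_int_diff)
  next
    case False
    thus ?thesis using g[of x "2 * m + 1 - y"] b n that
      by (auto simp: H_def extend_mirror_def corner_flip_def simp flip: of_int_diff)
  qed
  hence "second_difference (H True) - second_difference (H False)
      = (second_difference (corner_flip CARD('n) (a, b)) :: 'n square)"
    unfolding second_difference_diff[symmetric] by (intro second_difference_cong) auto
  with vs show ?thesis using that by blast
qed

text \<open>In a difference of corner sums the forced values and the summand \<open>real a\<close>
  of the mirror rule cancel. What remains is antisymmetric under reflection and supported on the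
  free cells and their mirror images, so its values are its coefficients with respect to the
  flips.\<close>

lemma diff_VSASM_eq_sum_flips:
  fixes X Y :: "'n::{finite,linorder} square"
  assumes n: "CARD('n) = 2 * m + 1" and X: "is_VSASM X" and Y: "is_VSASM Y"
  shows "X - Y = (\<Sum>p\<in>{2..<2*m} \<times> {1..<m}.
     (corner_sum X (fst p) (snd p) - corner_sum Y (fst p) (snd p)) *\<^sub>R second_difference (corner_flip CARD('n) p))"
    (is "_ = (\<Sum>p\<in>?I. ?u p *\<^sub>R _)")
proof -
  define d where "d a b = corner_sum X a b - corner_sum Y a b" for a b
  have HX: "corner_sum_function CARD('n) (corner_sum X)" and HY: "corner_sum_function CARD('n) (corner_sum Y)"
    using X Y by (auto simp: is_VSASM_def corner_sum_function_if_ASM)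
  have mirror: "d a (CARD('n) - b) = - d a b" if "a \<le> CARD('n)" "b \<le> CARD('n)" for a b
    using corner_sum_VSASM_mirror[OF X that] corner_sum_VSASM_mirror[OF Y that] by (simp add: d_def)
  have half: "d a b = (\<Sum>p\<in>?I. d (fst p) (snd p) * (if (a, b) = p then 1 else 0))"
    if "a \<le> CARD('n)" "b \<le> m" for a b
  proof -
    have "d a b = 0" if "(a, b) \<notin> ?I"
    proof -
      note mir = corner_sum_VSASM_mirror[OF X] corner_sum_VSASM_mirror[OF Y]
      from that \<open>a \<le> _\<close> \<open>b \<le> m\<close> n consider "a = 0" | "a = CARD('n)" | "b = 0" | "b = m" | "a = 1" | "a = 2 * m"
        by fastforce
      thus ?thesis
      proof cases
        case 2
        thus ?thesis using HX HY \<open>b \<le> m\<close> n by (simp add: d_def corner_sum_function_def)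
      next
        case 4
        thus ?thesis using symmetric_corner_sum_middle[OF n HX mir(1)]
            symmetric_corner_sum_middle[OF n HY mir(2)] \<open>a \<le> _\<close> by (simp add: d_def)
      next
        case 5
        thus ?thesis using symmetric_corner_sum_first_row[OF n HX mir(1)]
            symmetric_corner_sum_first_row[OF n HY mir(2)] \<open>b \<le> m\<close> by (simp add: d_def)
      next
        case 6
        thus ?thesis using symmetric_corner_sum_last_row[OF n HX mir(1)]
            symmetric_corner_sum_last_row[OF n HY mir(2)] \<open>b \<le> m\<close> by (simp add: d_def)
      qed (auto simp: d_def)
    qed
    thus ?thesis by (simp add: if_distrib[of "\<lambda>x. _ * x"] sum.delta' cong: if_cong)
  qed
  \<comment> \<open>Cells of \<open>?I\<close> lie in columns below \<open>m\<close>, so the left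
    half sees only the entry 1 of a flip and the right half only the entry -1.\<close>
  have all: "d a b = (\<Sum>p\<in>?I. ?u p * corner_flip CARD('n) p a b)" if ab: "a \<le> CARD('n)" "b \<le> CARD('n)" for a b
  proof (cases "b \<le> m")
    case True
    have "(\<Sum>p\<in>?I. ?u p * corner_flip CARD('n) p a b) = (\<Sum>p\<in>?I. d (fst p) (snd p) * (if (a, b) = p then 1 else 0))"
      using True n by (intro sum.cong) (auto simp: d_def corner_flip_def)
    thus ?thesis using half[OF ab(1) True] by simp
  next
    case False
    have "(\<Sum>p\<in>?I. ?u p * corner_flip CARD('n) p a b)
        = (\<Sum>p\<in>?I. - (d (fst p) (snd p) * (if (a, CARD('n) - b) = p then 1 else 0)))"
      using False n by (intro sum.cong) (auto simp: d_def corner_flip_def)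
    thus ?thesis using half[OF ab(1), of "CARD('n) - b"] mirror[OF ab] False n by (simp add: sum_negf)
  qed
  have "X - Y = second_difference (\<lambda>a b. d a b)"
    unfolding d_def second_difference_diff by (simp add: second_difference_corner_sum)
  also have "\<dots> = second_difference (\<lambda>a b. \<Sum>p\<in>?I. ?u p * corner_flip CARD('n) p a b)"
    by (rule second_difference_cong) (rule all)
  finally show ?thesis by (simp add: second_difference_sum)
qed

text \<open>Applying \<open>f i\<close> to a vanishing linear combination isolates the coefficient
  of \<open>v i\<close>.\<close>

lemma independent_if_biorthogonal:
  fixes v :: "'i \<Rightarrow> 'a::real_vector" and f :: "'i \<Rightarrow> 'a \<Rightarrow> real"
  assumes "finite I" "\<And>i. i \<in> I \<Longrightarrow> linear (f i)"
    and dual: "\<And>i j. i \<in> I \<Longrightarrow> j \<in> I \<Longrightarrow> f i (v j) = (if i = j then 1 else 0)"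
  shows "inj_on v I" "independent (v ` I)"
proof -
  show inj: "inj_on v I"
    by (rule inj_onI) (metis dual zero_neq_one)
  show "independent (v ` I)"
  proof
    assume "dependent (v ` I)"
    then obtain u where u: "\<exists>x\<in>v ` I. u x \<noteq> 0" "(\<Sum>x\<in>v ` I. u x *\<^sub>R x) = 0"
      using dependent_finite[of "v ` I"] assms(1) by auto
    then obtain i where i: "i \<in> I" "u (v i) \<noteq> 0" by auto
    have "0 = f i (\<Sum>j\<in>I. u (v j) *\<^sub>R v j)"
      using u(2) linear_0[OF assms(2)[OF i(1)]] by (simp add: sum.reindex[OF inj])
    also have "\<dots> = (\<Sum>j\<in>I. u (v j) * f i (v j))"
      by (simp add: linear_sum[OF assms(2)[OF i(1)]] linear_cmul[OF assms(2)[OF i(1)]])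
    also have "\<dots> = (\<Sum>j\<in>I. if i = j then u (v j) else 0)"
      by (rule sum.cong) (auto simp: dual i)
    also have "\<dots> = u (v i)" using assms(1) i by simp
    finally show False using i by simp
  qed
qed

section \<open>The dimension of the affine hull\<close>

theorem theorem3p7:
  assumes "odd CARD('n::{finite,linorder})" and "CARD('n) \<ge> 3"
  shows "real_of_int (aff_dim (P_VSASM :: (real ^ ('n::{finite,linorder}) ^ ('n::{finite,linorder})) set)) =
    (real CARD('n) - 3)\<^sup>2 / 2"
proof -
  obtain m where n: "CARD('n) = 2 * m + 1" using assms(1) by (elim oddE) auto
  have m: "m \<ge> 1" using assms(2) n by simp
  define S where "S = {X :: 'n square. is_VSASM X}"
  define I where "I = {2..<2*m} \<times> {1..<m}"
  define D :: "nat \<times> nat \<Rightarrow> 'n square" where "D p = second_difference (corner_flip CARD('n) p)" for p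
  \<comment> \<open>Any VSASM would serve as base point. Clamping 0 gives the one whose corner sums
    in the left half are smallest.\<close>
  define A :: "'n square" where
    "A = second_difference (extend_mirror m (clamp_corner m (\<lambda>a b. 0)))"
  have A: "A \<in> S"
    unfolding A_def S_def mem_Collect_eq
  proof (rule is_VSASM_second_difference)
    show "corner_sum_function CARD('n) (extend_mirror m (clamp_corner m (\<lambda>a b. 0)))"
      unfolding n by (rule corner_sum_function_clamp) auto
  qed (unfold n, rule extend_mirror_mirror)
  \<comment> \<open>The corner sums at the cells of \<open>I\<close> are functionals dual to the
    flips: the mirror image of a cell of \<open>I\<close> lies right of the middle and so outside
    \<open>I\<close>.\<close>
  have "corner_sum (D q) (fst p) (snd p) = (if p = q then 1 else 0)" if "p \<in> I" "q \<in> I" for p q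
  proof -
    have "corner_sum (D q) (fst p) (snd p) = corner_flip CARD('n) q (fst p) (snd p)"
      unfolding D_def using that n
      by (intro corner_sum_second_difference) (auto simp: I_def corner_flip_def)
    thus ?thesis using that n by (auto simp: I_def corner_flip_def)
  qed
  hence inj: "inj_on D I" and ind: "independent (D ` I)"
    using independent_if_biorthogonal[of I "\<lambda>p X. corner_sum X (fst p) (snd p)" D]
    by (auto simp: I_def linear_corner_sum)
  \<comment> \<open>Differences from \<open>A\<close> are combinations of flips; conversely, each
    flip is a difference of two VSASMs, in which the base point cancels.\<close>
  have "span ((\<lambda>X. - A + X) ` S) = span (D ` I)"
  proof (rule span_eq[THEN iffD2], intro conjI subsetI)
    fix Z assume "Z \<in> (\<lambda>X. - A + X) ` S"
    then obtain X where X: "X \<in> S" "Z = X - A" by auto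
    have "X - A = (\<Sum>p\<in>I. (corner_sum X (fst p) (snd p) - corner_sum A (fst p) (snd p)) *\<^sub>R D p)"
      using diff_VSASM_eq_sum_flips[OF n, of X A] X A by (simp add: S_def I_def D_def)
    thus "Z \<in> span (D ` I)"
      unfolding X(2) by (simp only:) (intro span_sum span_scale span_base imageI)
  next
    fix Z assume "Z \<in> D ` I"
    then obtain a b where p: "(a, b) \<in> I" and Z: "Z = D (a, b)" by auto
    obtain X Y :: "'n square" where XY: "is_VSASM X" "is_VSASM Y" "X - Y = D (a, b)"
      using flip_VSASM[OF n, of a b] p by (auto simp: I_def D_def)
    have "(- A + X) - (- A + Y) \<in> span ((\<lambda>X. - A + X) ` S)"
      using XY by (intro span_diff span_base) (auto simp: S_def)
    thus "Z \<in> span ((\<lambda>X. - A + X) ` S)" using XY Z by simp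
  qed
  hence "dim ((\<lambda>X. - A + X) ` S) = dim (D ` I)" by (rule span_eq_dim)
  also have "\<dots> = card I" using ind inj by (simp add: dim_eq_card_independent card_image)
  also have "\<dots> = (2 * m - 2) * (m - 1)" by (simp add: I_def)
  finally have "aff_dim S = int ((2 * m - 2) * (m - 1))"
    using aff_dim_eq_dim[OF hull_inc[OF A]] by simp
  hence "aff_dim (P_VSASM :: ('n square) set) = int ((2 * m - 2) * (m - 1))"
    by (simp add: P_VSASM_def S_def aff_dim_convex_hull)
  \<comment> \<open>With \<open>m \<ge> 1\<close> the natural subtractions do not truncate, and both
    sides are \<open>2 * (m - 1)\<^sup>2\<close>.\<close>
  moreover have "real ((2 * m - 2) * (m - 1)) = (real CARD('n) - 3)\<^sup>2 / 2"
    using m by (simp add: n of_nat_diff power2_eq_square field_simps)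
  ultimately show ?thesis by (metis of_int_of_nat_eq)
qed

end
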